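(* Let $c>0$, let $\gamma$ denote Euler's constant, and let $\varphi(r)=(r^2+c^2)^{3/2}$, $r\ge0$, be the generalised multiquadric function. Define $$\begin{aligned} \mu_{-4}=\mu_4&=\tfrac{1}{11520}\left(28+60c^2+15c^4+60c^4\gamma-60c^4\log 2+60c^4\log c\right),\\ \mu_{-3}=\mu_3&=\tfrac{1}{480}\left(-16-30c^2-5c^4-20c^4\gamma+20c^4\log 2-20c^4\log c\right),\\ \mu_{-2}=\mu_2&=\tfrac{1}{2880}\left(676+780c^2+105c^4+420c^4\gamma-420c^4\log 2+420c^4\log c\right),\\ \mu_{-1}=\mu_1&=\tfrac{1}{1440}\left(-976-870c^2-105c^4-420c^4\gamma+420c^4\log 2-420c^4\log c\right),\\ \mu_0&=\tfrac{1}{384}\left(364+300c^2+35c^4+140c^4\gamma-140c^4\log 2+140c^4\log c\right), \end{aligned}$$ and let $$\psi(x)=\sum_{k=-4}^{4}\mu_k\,\varphi(|x-k|),\qquad x\in\mathbb{R}.$$ Then quasi-interpolation with $\psi$ is exact for cubic polynomials: for every polynomial $p$ of degree at most $3$, $$\sum_{k\in\mathbb{Z}}p(k)\,\psi(x-k)=p(x)\qquad\text{for all }x\in\mathbb{R}.$$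
   Context: The space dimension is $n=1$. The function $\psi$ is called the quasi-Lagrange function formed from integer shifts of $\varphi(|\cdot|)$ with coefficients $\mu_k$. *)

theory Defs
  imports "HOL-Analysis.Analysis" "HOL-Computational_Algebra.Polynomial"
begin

definition multiquadric :: "real \<Rightarrow> real \<Rightarrow> real" where
  "multiquadric c r = (r\<^sup>2 + c\<^sup>2) powr (3 / 2)"

text \<open>The coefficients \<open>\<mu>\<^sub>k\<close> for \<open>\<bar>k\<bar> \<le> 4\<close>; the value \<open>0\<close> outside this range is a dummy
  that the quasi-Lagrange function below never uses.\<close>

definition \<mu> :: "real \<Rightarrow> int \<Rightarrow> real" where
  "\<mu> c k =
    (if \<bar>k\<bar> = 4 then
       1 / 11520 * (28 + 60 * c^2 + 15 * c^4 + 60 * c^4 * euler_mascheroni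
                    - 60 * c^4 * ln 2 + 60 * c^4 * ln c)
     else if \<bar>k\<bar> = 3 then
       1 / 480 * (- 16 - 30 * c^2 - 5 * c^4 - 20 * c^4 * euler_mascheroni
                  + 20 * c^4 * ln 2 - 20 * c^4 * ln c)
     else if \<bar>k\<bar> = 2 then
       1 / 2880 * (676 + 780 * c^2 + 105 * c^4 + 420 * c^4 * euler_mascheroni
                   - 420 * c^4 * ln 2 + 420 * c^4 * ln c)
     else if \<bar>k\<bar> = 1 then
       1 / 1440 * (- 976 - 870 * c^2 - 105 * c^4 - 420 * c^4 * euler_mascheroni
                   + 420 * c^4 * ln 2 - 420 * c^4 * ln c)
     else if k = 0 then
       1 / 384 * (364 + 300 * c^2 + 35 * c^4 + 140 * c^4 * euler_mascheroni
                  - 140 * c^4 * ln 2 + 140 * c^4 * ln c)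
     else 0)"

definition quasi_lagrange :: "real \<Rightarrow> real \<Rightarrow> real" where
  "quasi_lagrange c x = (\<Sum>k = -4..4. \<mu> c k * multiquadric c \<bar>x - of_int k\<bar>)"

end

theory Submission
  imports Defs "HOL-Real_Asymp.Real_Asymp"
begin

text \<open>
Write \<open>\<Delta>\<close> for the forward difference with step 1. The coefficients \<open>\<mu>\<^sub>k\<close> annihilate cubics, so they
factor through the fourth difference: \<open>\<psi>(x) = (\<Sum>\<bar>j\<bar>\<le>2. w\<^sub>j \<Delta>\<^sup>4\<phi>(x - j - 2))\<close>
(lemma \<open>quasi_lagrange_eq_fdiff\<close>). It is therefore enough to sum cubic polynomials against
\<open>\<Delta>\<^sup>4\<phi>\<close>.

Repeated summation by parts turns \<open>q \<Delta>\<^sup>4f\<close>, for cubic \<open>q\<close>, into \<open>T\<^sub>f(y + 1) - T\<^sub>f(y)\<close>, where the boundary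
term \<open>T\<^sub>f\<close> is linear in \<open>f\<close> (lemma \<open>fdiff_parts_boundary\<close>). The sum over the integers then only sees
the behaviour of \<open>\<phi>\<close> at infinity. There
\<open>\<phi>(y) = \<sigma> (y\<^sup>3 + (3/2) c\<^sup>2 y) + h(y)\<close>, with \<open>\<sigma> = 1\<close> towards \<open>\<infinity>\<close> and \<open>\<sigma> = -1\<close> towards \<open>-\<infinity>\<close>,
where \<open>h(y) = O(1/\<bar>y\<bar>)\<close>, and every derivative of \<open>h\<close> gains one more order of decay. By the mean value
theorem for differences \<open>\<Delta>\<^sup>jh\<close> decays like the \<open>j\<close>-th derivative, which makes \<open>T\<^sub>h\<close> vanish in the limit.
The cubic \<open>P(y) = y\<^sup>3 + (3/2) c\<^sup>2 y\<close> has \<open>\<Delta>\<^sup>4P = 0\<close>, so its boundary term \<open>T\<^sub>P\<close> is a constant \<open>K\<close>, and the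
sum equals \<open>K - (-K) = 2K\<close>. Evaluating \<open>K\<close> gives
\<open>(\<Sum>k. p(k) \<Delta>\<^sup>4\<phi>(z - k - 2)) = 12 p(z) + (2 + 3 c\<^sup>2) p''(z)\<close>
(lemma \<open>has_sum_poly_fdiff\<close>). What is left is the effect of the weights \<open>w\<^sub>j\<close>: their zeroth moment \<open>1/12\<close>
normalises the first term, and their second moment cancels the term with \<open>p''\<close>
(lemma \<open>fdiff_weight_moments\<close>). The part of the \<open>\<mu>\<^sub>k\<close> containing Euler's constant and the logarithms is
a multiple of the eighth difference and drops out of both moments.
\<close>

section \<open>Forward differences and summation by parts\<close>

definition fdiff :: "(real \<Rightarrow> real) \<Rightarrow> real \<Rightarrow> real" where "fdiff f y = f (y + 1) - f y"

lemma fdiff_Suc: "(fdiff ^^ Suc n) f y = (fdiff ^^ n) f (y + 1) - (fdiff ^^ n) f y"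
  by (simp add: fdiff_def)

text \<open>The boundary term left over by \<open>n\<close> summations by parts in \<open>\<Sum> q \<Delta>\<^sup>nf\<close>. The arguments of \<open>q\<close> are
  shifted back by one with each step because
  \<open>\<Delta>(u(y - 1) v(y)) = u(y) \<Delta>v(y) + \<Delta>u(y - 1) v(y)\<close>.\<close>
definition parts_boundary :: "nat \<Rightarrow> (real \<Rightarrow> real) \<Rightarrow> (real \<Rightarrow> real) \<Rightarrow> real \<Rightarrow> real" where
  "parts_boundary n q f y = (\<Sum>i<n. (-1) ^ i * (fdiff ^^ i) q (y - 1 - real i) * (fdiff ^^ (n - 1 - i)) f y)"

text \<open>By the product rule just mentioned, the difference of the \<open>i\<close>-th summand is \<open>s\<^sub>i - s\<^sub>i\<^sub>+\<^sub>1\<close> with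
  \<open>s\<^sub>i = (-1)\<^sup>i \<Delta>\<^sup>iq(y - i) \<Delta>\<^sup>n\<^sup>-\<^sup>if(y)\<close>, so only \<open>s\<^sub>0\<close> and \<open>s\<^sub>n\<close> survive. If \<open>q\<close> is a polynomial of degree less than
  \<open>n\<close>, the last term vanishes and \<open>q \<Delta>\<^sup>nf\<close> telescopes.\<close>
lemma fdiff_parts_boundary:
  "parts_boundary n q f (y + 1) - parts_boundary n q f y =
     q y * (fdiff ^^ n) f y - (-1) ^ n * (fdiff ^^ n) q (y - real n) * f y"
proof -
  define s where "s = (\<lambda>i. (-1) ^ i * (fdiff ^^ i) q (y - real i) * (fdiff ^^ (n - i)) f y)"
  have "parts_boundary n q f (y + 1) - parts_boundary n q f y = (\<Sum>i<n. s i - s (Suc i))"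
    unfolding parts_boundary_def sum_subtractf [symmetric]
  proof (intro sum.cong refl)
    fix i assume "i \<in> {..<n}"
    then have n: "n - i = Suc (n - 1 - i)" "n - Suc i = n - 1 - i" by auto
    have shift: "y + 1 - 1 - real i = y - real i" "y - real (Suc i) = y - 1 - real i"
      "y - 1 - real i + 1 = y - real i"
      by simp_all
    have "s i = (-1) ^ i * (fdiff ^^ i) q (y - real i) *
        ((fdiff ^^ (n - 1 - i)) f (y + 1) - (fdiff ^^ (n - 1 - i)) f y)"
      unfolding s_def n(1) fdiff_Suc ..
    moreover have "s (Suc i) = - ((-1) ^ i * ((fdiff ^^ i) q (y - real i) - (fdiff ^^ i) q (y - 1 - real i)) *
        (fdiff ^^ (n - 1 - i)) f y)"
      unfolding s_def n(2) shift fdiff_Suc by simp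
    ultimately show "(-1) ^ i * (fdiff ^^ i) q (y + 1 - 1 - real i) * (fdiff ^^ (n - 1 - i)) f (y + 1) -
       (-1) ^ i * (fdiff ^^ i) q (y - 1 - real i) * (fdiff ^^ (n - 1 - i)) f y = s i - s (Suc i)"
      unfolding shift by (simp only: algebra_simps)
  qed
  also have "\<dots> = s 0 - s n" by (simp add: sum_lessThan_telescope')
  finally show ?thesis by (simp add: s_def)
qed

lemma fdiff_funpow_diff: "(fdiff ^^ n) (\<lambda>y. f y - g y) y = (fdiff ^^ n) f y - (fdiff ^^ n) g y"
  by (induction n arbitrary: y) (simp_all add: fdiff_def)

lemma parts_boundary_diff:
  "parts_boundary n q (\<lambda>y. f y - g y) y = parts_boundary n q f y - parts_boundary n q g y"
  by (simp add: parts_boundary_def fdiff_funpow_diff algebra_simps sum_subtractf)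

section \<open>Decay of differences from decay of derivatives\<close>

lemma eventually_neq_0_at_ends:
  assumes "A = at_top \<or> A = at_bot"
  shows "eventually (\<lambda>y::real. y \<noteq> 0) A"
  using assms eventually_gt_at_top [of "0::real"] eventually_gt_at_bot [of "0::real"]
  by (auto elim: eventually_mono)

lemma DERIV_fdiff_funpow:
  assumes "\<And>y. (f has_real_derivative f' y) (at y)"
  shows "((fdiff ^^ n) f has_real_derivative (fdiff ^^ n) f' y) (at y)"
proof (induction n arbitrary: y)
  case 0
  then show ?case using assms by simp
next
  case (Suc n)
  have "((\<lambda>y. (fdiff ^^ n) f (y + 1)) has_real_derivative (fdiff ^^ n) f' (y + 1)) (at y)"
    using Suc [of "y + 1"] by (simp add: DERIV_shift)
  from DERIV_diff [OF this Suc] show ?case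
    unfolding fdiff_Suc [abs_def] .
qed

text \<open>Differencing commutes with differentiation, so the ordinary mean value theorem applied to
  \<open>\<Delta>\<^sup>nF\<close> replaces one difference by one derivative; induction does the rest.\<close>
lemma fdiff_mean_value:
  assumes "\<And>i y. i < n \<Longrightarrow> (F i has_real_derivative F (Suc i) y) (at y)"
  shows "\<exists>\<xi>. y \<le> \<xi> \<and> \<xi> \<le> y + real n \<and> (fdiff ^^ n) (F 0) y = F n \<xi>"
  using assms
proof (induction n arbitrary: F y)
  case 0
  then show ?case by auto
next
  case (Suc n)
  have "((fdiff ^^ n) (F 0) has_real_derivative (fdiff ^^ n) (F 1) t) (at t)" for t
    by (rule DERIV_fdiff_funpow) (use Suc.prems [of 0] in simp)
  then obtain \<eta> where \<eta>: "y < \<eta>" "\<eta> < y + 1"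
      "(fdiff ^^ n) (F 0) (y + 1) - (fdiff ^^ n) (F 0) y = (fdiff ^^ n) (F 1) \<eta>"
    using MVT2 [of y "y + 1" "(fdiff ^^ n) (F 0)" "(fdiff ^^ n) (F 1)"] by auto
  obtain \<xi> where "\<eta> \<le> \<xi>" "\<xi> \<le> \<eta> + real n" "(fdiff ^^ n) (F 1) \<eta> = F (Suc n) \<xi>"
    using Suc.IH [of "\<lambda>i. F (Suc i)" \<eta>] Suc.prems by auto
  with \<eta> show ?case
    unfolding fdiff_Suc by (intro exI [of _ \<xi>]) auto
qed

text \<open>The mean value point \<open>\<xi>(y)\<close> stays within distance \<open>n\<close> of \<open>y\<close>; hence \<open>\<xi>(y)/y\<close> tends to 1 and the
  power \<open>y\<^sup>m\<close> may be exchanged for \<open>\<xi>(y)\<^sup>m\<close>.\<close>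
lemma tendsto_power_mult_fdiff:
  assumes F: "\<And>i y. i < n \<Longrightarrow> (F i has_real_derivative F (Suc i) y) (at y)"
    and lim: "((\<lambda>y. y ^ m * F n y) \<longlongrightarrow> L) A"
    and A: "A = at_top \<or> A = at_bot"
  shows "((\<lambda>y. y ^ m * (fdiff ^^ n) (F 0) y) \<longlongrightarrow> L) A"
proof -
  have "\<exists>\<xi>. \<forall>y. y \<le> \<xi> y \<and> \<xi> y \<le> y + real n \<and> (fdiff ^^ n) (F 0) y = F n (\<xi> y)"
    using fdiff_mean_value [of n F, OF F] by metis
  then obtain \<xi> where \<xi>: "\<And>y. y \<le> \<xi> y" "\<And>y. \<xi> y \<le> y + real n"
      "\<And>y. (fdiff ^^ n) (F 0) y = F n (\<xi> y)" by blast
  note nz = eventually_neq_0_at_ends [OF A]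
  have \<xi>_lim: "filterlim \<xi> A A"
    using A
  proof
    assume "A = at_top"
    then show ?thesis
      using filterlim_at_top_mono [OF filterlim_ident, of \<xi>] \<xi>(1) by simp
  next
    assume "A = at_bot"
    moreover have "filterlim (\<lambda>y. y + real n) at_bot at_bot" by real_asymp
    ultimately show ?thesis
      using \<xi>(2) filterlim_at_bot_mono by (metis (no_types, lifting) always_eventually)
  qed
  then have lim': "((\<lambda>y. \<xi> y ^ m * F n (\<xi> y)) \<longlongrightarrow> L) A"
    by (rule filterlim_compose [OF lim])
  have "((\<lambda>y. \<xi> y / y - 1) \<longlongrightarrow> 0) A"
  proof (rule Lim_null_comparison)
    show "((\<lambda>y. real n / \<bar>y\<bar>) \<longlongrightarrow> 0) A"
      using A by (elim disjE; simp; real_asymp)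
    show "eventually (\<lambda>y. norm (\<xi> y / y - 1) \<le> real n / \<bar>y\<bar>) A"
      using nz
    proof eventually_elim
      case (elim y)
      have "\<xi> y / y - 1 = (\<xi> y - y) / y" using elim by (simp add: field_simps)
      then show ?case using \<xi>(1,2) [of y] by (simp add: divide_right_mono)
    qed
  qed
  then have "((\<lambda>y. \<xi> y / y) \<longlongrightarrow> 1) A"
    by (rule LIM_zero_cancel)
  then have "((\<lambda>y. \<xi> y ^ m * F n (\<xi> y) / (\<xi> y / y) ^ m) \<longlongrightarrow> L / 1 ^ m) A"
    by (intro tendsto_divide [OF lim' tendsto_power]) auto
  moreover have "eventually (\<lambda>y. \<xi> y ^ m * F n (\<xi> y) / (\<xi> y / y) ^ m = y ^ m * (fdiff ^^ n) (F 0) y) A"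
    using nz eventually_compose_filterlim [OF nz \<xi>_lim]
    by eventually_elim (simp add: \<xi>(3) power_divide)
  ultimately show ?thesis
    by (simp add: Lim_transform_eventually)
qed

section \<open>Sums over the integers of decaying differences\<close>

lemma has_sum_nat_if_quadratic_decay:
  fixes f :: "nat \<Rightarrow> real"
  assumes "f sums S" and lim: "(\<lambda>n. real n ^ 2 * f n) \<longlonglongrightarrow> L"
  shows "(f has_sum S) UNIV"
proof (rule norm_summable_imp_has_sum [OF _ assms(1)])
  have "f \<in> O(\<lambda>n. 1 / real n ^ 2)"
  proof (rule bigoI_tendsto)
    show "((\<lambda>n. f n / (1 / real n ^ 2)) \<longlongrightarrow> L) at_top"
      using lim by (simp add: mult.commute)
  qed (auto intro: eventually_mono [OF eventually_gt_at_top [of 0]])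
  then have "(\<lambda>n. norm (f n)) \<in> O(\<lambda>n. 1 / real n ^ 2)"
    by simp
  moreover have "summable (\<lambda>n. norm (1 / real n ^ 2))"
    using inverse_power_summable [of 2, where 'a = real] by (simp add: inverse_eq_divide)
  ultimately show "summable (\<lambda>n. norm (f n))"
    by (rule summable_comparison_test_bigo [rotated])
qed

text \<open>Telescoping gives only the convergence of the two half sums in their natural order. The quadratic
  decay adds absolute convergence, which the unordered sum over the integers requires.\<close>
lemma has_sum_int_telescope:
  fixes a T :: "real \<Rightarrow> real"
  assumes tele: "\<And>y. a y = T (y + 1) - T y"
    and top: "(T \<longlongrightarrow> A) at_top" "((\<lambda>y. y\<^sup>2 * a y) \<longlongrightarrow> L) at_top"
    and bot: "(T \<longlongrightarrow> B) at_bot" "((\<lambda>y. y\<^sup>2 * a y) \<longlongrightarrow> M) at_bot"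
  shows "((\<lambda>k::int. a (x + of_int k)) has_sum (A - B)) UNIV"
proof -
  have up: "filterlim (\<lambda>n. x + real n) at_top sequentially" by real_asymp
  have down: "filterlim (\<lambda>n. x - real n) at_bot sequentially"
    "filterlim (\<lambda>n. x - 1 - real n) at_bot sequentially" by real_asymp+
  \<comment> \<open>The indices \<open>k \<ge> 0\<close> contribute \<open>A - T x\<close>.\<close>
  have "(\<lambda>n. T (x + real (Suc n)) - T (x + real n)) sums (A - T (x + real 0))"
    by (intro telescope_sums filterlim_compose [OF top(1) up])
  moreover have "T (x + real (Suc n)) - T (x + real n) = a (x + real n)" for n
    by (simp add: tele add_ac)
  ultimately have sums_up: "(\<lambda>n. a (x + real n)) sums (A - T x)"
    by simp
  have "(\<lambda>n. (real n / (x + real n))^2 * ((x + real n)\<^sup>2 * a (x + real n))) \<longlonglongrightarrow> 1^2 * L"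
    by (intro tendsto_mult tendsto_power filterlim_compose [OF top(2) up]) real_asymp
  moreover have "eventually (\<lambda>n. (real n / (x + real n))^2 * ((x + real n)\<^sup>2 * a (x + real n))
      = real n ^ 2 * a (x + real n)) sequentially"
    by (rule eventually_mono [OF eventually_compose_filterlim [OF eventually_gt_at_top [of 0] up]])
       (simp add: power_divide)
  ultimately have "(\<lambda>n. real n ^ 2 * a (x + real n)) \<longlonglongrightarrow> 1^2 * L"
    by (rule Lim_transform_eventually)
  from has_sum_nat_if_quadratic_decay [OF sums_up this]
  have nonneg: "((\<lambda>k. a (x + of_int k)) has_sum (A - T x)) (range int)"
    by (subst has_sum_reindex) (auto simp: o_def)
  \<comment> \<open>The indices \<open>k < 0\<close>, written as \<open>-1 - n\<close>, contribute \<open>T x - B\<close>.\<close>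
  have "(\<lambda>n. T (x - real n) - T (x - real (Suc n))) sums (T (x - real 0) - B)"
    by (intro telescope_sums' filterlim_compose [OF bot(1) down(1)])
  moreover have "T (x - real n) - T (x - real (Suc n)) = a (x - 1 - real n)" for n
    using tele [of "x - 1 - real n"] by (simp add: algebra_simps)
  ultimately have sums_down: "(\<lambda>n. a (x - 1 - real n)) sums (T x - B)"
    by simp
  have "(\<lambda>n. (real n / (x - 1 - real n))^2 * ((x - 1 - real n)\<^sup>2 * a (x - 1 - real n))) \<longlonglongrightarrow> (-1)^2 * M"
    by (intro tendsto_mult tendsto_power filterlim_compose [OF bot(2) down(2)]) real_asymp
  moreover have "eventually (\<lambda>n. (real n / (x - 1 - real n))^2 * ((x - 1 - real n)\<^sup>2 * a (x - 1 - real n))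
      = real n ^ 2 * a (x - 1 - real n)) sequentially"
    by (rule eventually_mono [OF eventually_compose_filterlim [OF eventually_gt_at_bot [of 0] down(2)]])
       (simp add: power_divide)
  ultimately have "(\<lambda>n. real n ^ 2 * a (x - 1 - real n)) \<longlonglongrightarrow> (-1)^2 * M"
    by (rule Lim_transform_eventually)
  from has_sum_nat_if_quadratic_decay [OF sums_down this]
  have neg: "((\<lambda>k. a (x + of_int k)) has_sum (T x - B)) (range (\<lambda>n. - 1 - int n))"
    by (subst has_sum_reindex) (auto simp: o_def inj_on_def algebra_simps)
  have "range int \<union> range (\<lambda>n. - 1 - int n) = UNIV"
  proof (intro equalityI subset_UNIV subsetI)
    fix k :: int
    have "k = int (nat k) \<or> k = - 1 - int (nat (- 1 - k))" by auto
    then show "k \<in> range int \<union> range (\<lambda>n. - 1 - int n)" by blast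
  qed
  moreover have "range int \<inter> range (\<lambda>n. - 1 - int n) = {}" by auto
  ultimately show ?thesis using has_sum_Un_disjoint [OF nonneg neg] by simp
qed

lemma has_sum_finite_sum:
  fixes f :: "'i \<Rightarrow> 'a \<Rightarrow> real"
  assumes "finite I" and "\<And>i. i \<in> I \<Longrightarrow> (f i has_sum s i) A"
  shows "((\<lambda>x. \<Sum>i\<in>I. f i x) has_sum (\<Sum>i\<in>I. s i)) A"
  using assms by (induction I rule: finite_induct) (auto intro!: has_sum_add)

section \<open>The generalised multiquadric and its cubic asymptote\<close>

text \<open>The \<open>n\<close>-th derivative of \<open>(y\<^sup>2 + c\<^sup>2)\<^sup>3\<^sup>/\<^sup>2\<close> for \<open>n \<le> 4\<close>; larger \<open>n\<close> get a dummy value. Powers of the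
  square root \<open>s\<close> instead of \<open>powr\<close> keep the derivatives rational in \<open>y\<close> and \<open>s\<close>.\<close>
definition multiquadric_deriv :: "real \<Rightarrow> nat \<Rightarrow> real \<Rightarrow> real" where
  "multiquadric_deriv c n = (\<lambda>y. let s = sqrt (y^2 + c^2) in
     if n = 0 then s ^ 3
     else if n = 1 then 3 * y * s
     else if n = 2 then 3 * s + 3 * y^2 / s
     else if n = 3 then 9 * y / s - 3 * y^3 / s^3
     else 9 * c^4 / s^5)"

text \<open>The derivatives of the cubic asymptote, the polynomial part of the expansion
  \<open>(y\<^sup>2 + c\<^sup>2)\<^sup>3\<^sup>/\<^sup>2 = y\<^sup>3 + (3/2) c\<^sup>2 y + (3/8) c\<^sup>4 / y + \<dots>\<close> for \<open>y \<rightarrow> \<infinity>\<close>.\<close>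
definition cubic_deriv :: "real \<Rightarrow> nat \<Rightarrow> real \<Rightarrow> real" where
  "cubic_deriv c n = (\<lambda>y.
     if n = 0 then y^3 + 3/2*c^2*y
     else if n = 1 then 3 * y^2 + 3/2*c^2
     else if n = 2 then 6 * y
     else if n = 3 then 6
     else 0)"

lemma DERIV_cubic_deriv: "(cubic_deriv c n has_real_derivative cubic_deriv c (Suc n) y) (at y)"
proof -
  have "(cubic_deriv c 0 has_real_derivative cubic_deriv c 1 y) (at y)"
    "(cubic_deriv c 1 has_real_derivative cubic_deriv c 2 y) (at y)"
    "(cubic_deriv c 2 has_real_derivative cubic_deriv c 3 y) (at y)"
    "(cubic_deriv c 3 has_real_derivative 0) (at y)"
    unfolding cubic_deriv_def by (auto intro!: derivative_eq_intros simp: power2_eq_square)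
  then show ?thesis
    by (cases "n = 0 \<or> n = 1 \<or> n = 2 \<or> n = 3")
       (auto simp: cubic_deriv_def numeral_2_eq_2 numeral_3_eq_3)
qed

lemma lt4: "(n::nat) < 4 \<longleftrightarrow> n = 0 \<or> n = 1 \<or> n = 2 \<or> n = 3" by auto

lemma DERIV_multiquadric_deriv:
  assumes c: "c > 0" and n: "n < 4"
  shows "(multiquadric_deriv c n has_real_derivative multiquadric_deriv c (Suc n) y) (at y)"
proof -
  define s where "s = sqrt (y^2 + c^2)"
  have pos: "y^2 + c^2 > 0" using c by (simp add: add_nonneg_pos)
  hence s: "s > 0" "s^2 = y^2 + c^2" "sqrt (y^2+c^2) = s" by (auto simp: s_def)
  have s': "((\<lambda>y. sqrt (y^2+c^2)) has_real_derivative y / s) (at y)"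
    using pos s by (auto intro!: derivative_eq_intros simp: field_simps)
  define S where "S = (\<lambda>y. sqrt (y^2 + c^2))"
  have S: "(S has_real_derivative y / s) (at y)" "S y = s" using s' s by (simp_all add: S_def)
  note [derivative_intros] = S(1)
  have D0: "((\<lambda>y. S y ^ 3) has_real_derivative 3 * y * s) (at y)"
    using s(1) by (auto intro!: derivative_eq_intros simp: S power2_eq_square)
  have D1: "((\<lambda>y. 3 * y * S y) has_real_derivative 3 * s + 3 * y^2 / s) (at y)"
    using s(1) by (auto intro!: derivative_eq_intros simp: S power2_eq_square)
  have D2: "((\<lambda>y. 3 * S y + 3 * y^2 / S y) has_real_derivative 9 * y / s - 3 * y^3 / s^3) (at y)"
    using s(1) by (auto intro!: derivative_eq_intros simp: S field_simps power2_eq_square power3_eq_cube)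
  \<comment> \<open>Differentiation produces \<open>9 (s\<^sup>2 - y\<^sup>2)\<^sup>2 / s\<^sup>5\<close>, and \<open>s\<^sup>2 - y\<^sup>2 = c\<^sup>2\<close>.\<close>
  have "9 * c^4 / s^5 = 9 / s - 18 * y^2 / s^3 + 9 * y^4 / s^5"
  proof -
    have "9 * c^4 = 9 * (s^2 - y^2)^2" using s(2) by simp
    also have "\<dots> = 9 * s^4 - 18 * y^2 * s^2 + 9 * y^4" by algebra
    finally have "9 * c^4 / s^5 = 9 * s^4 / s^5 - 18 * y^2 * s^2 / s^5 + 9 * y^4 / s^5"
      by (simp only: add_divide_distrib diff_divide_distrib)
    then show ?thesis using s(1) by (simp add: eval_nat_numeral)
  qed
  moreover have "((\<lambda>y. 9 * y / S y - 3 * y^3 / S y ^3) has_real_derivative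
     9 / s - 18 * y^2 / s^3 + 9 * y^4 / s^5) (at y)"
    using s(1) by (auto intro!: derivative_eq_intros simp: S field_simps eval_nat_numeral)
  ultimately have D3: "((\<lambda>y. 9 * y / S y - 3 * y^3 / S y ^3) has_real_derivative 9 * c^4 / s^5) (at y)"
    by simp
  show ?thesis using D0 D1 D2 D3 n unfolding lt4
    by (elim disjE; simp add: multiquadric_deriv_def Let_def S_def s(3))
qed

text \<open>After subtraction of the cubic the leading term is \<open>(3/8) c\<^sup>4 / y\<close>, whose \<open>j\<close>-th derivative is of order
  \<open>y\<^sup>-\<^sup>1\<^sup>-\<^sup>j\<close>: the factor \<open>y\<^sup>j\<close> leaves one order to spare. The fourth derivative is \<open>9 c\<^sup>4 / s\<^sup>5\<close>; its order
  \<open>\<bar>y\<bar>\<^sup>-\<^sup>5\<close> is what makes sums against cubics converge absolutely.\<close>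
lemma multiquadric_asymptotics_top:
  assumes c: "c > 0"
  shows
  "((\<lambda>y. y^0 * (multiquadric_deriv c 0 y - cubic_deriv c 0 y)) \<longlongrightarrow> 0) at_top"
  "((\<lambda>y. y^1 * (multiquadric_deriv c 1 y - cubic_deriv c 1 y)) \<longlongrightarrow> 0) at_top"
  "((\<lambda>y. y^2 * (multiquadric_deriv c 2 y - cubic_deriv c 2 y)) \<longlongrightarrow> 0) at_top"
  "((\<lambda>y. y^3 * (multiquadric_deriv c 3 y - cubic_deriv c 3 y)) \<longlongrightarrow> 0) at_top"
  "((\<lambda>y. y^5 * (multiquadric_deriv c 4 y)) \<longlongrightarrow> 9*c^4) at_top"
  using c by (simp_all add: multiquadric_deriv_def cubic_deriv_def Let_def, real_asymp+)

lemma multiquadric_asymptotics_bot: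
  assumes c: "c > 0"
  shows
  "((\<lambda>y. y^0 * (multiquadric_deriv c 0 y + cubic_deriv c 0 y)) \<longlongrightarrow> 0) at_bot"
  "((\<lambda>y. y^1 * (multiquadric_deriv c 1 y + cubic_deriv c 1 y)) \<longlongrightarrow> 0) at_bot"
  "((\<lambda>y. y^2 * (multiquadric_deriv c 2 y + cubic_deriv c 2 y)) \<longlongrightarrow> 0) at_bot"
  "((\<lambda>y. y^3 * (multiquadric_deriv c 3 y + cubic_deriv c 3 y)) \<longlongrightarrow> 0) at_bot"
  "((\<lambda>y. y^5 * (multiquadric_deriv c 4 y)) \<longlongrightarrow> -9*c^4) at_bot"
  using c by (simp_all add: multiquadric_deriv_def cubic_deriv_def Let_def, real_asymp+)

lemma multiquadric_eq_deriv_0: "multiquadric c \<bar>y\<bar> = multiquadric_deriv c 0 y"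
proof -
  have "(y\<^sup>2 + c\<^sup>2) powr (3 / 2) = ((y\<^sup>2 + c\<^sup>2) powr (1 / 2)) powr 3"
    by (simp add: powr_powr)
  also have "\<dots> = sqrt (y\<^sup>2 + c\<^sup>2) ^ 3"
    by (simp add: powr_half_sqrt)
  finally show ?thesis
    by (simp add: multiquadric_def multiquadric_deriv_def)
qed

section \<open>Cubic polynomials summed against fourth differences\<close>

lemma parts_boundary_4:
  "parts_boundary 4 q f y = q (y - 1) * (fdiff ^^ 3) f y - fdiff q (y - 2) * (fdiff ^^ 2) f y
     + (fdiff ^^ 2) q (y - 3) * fdiff f y - (fdiff ^^ 3) q (y - 4) * f y"
  by (simp add: parts_boundary_def numeral_eq_Suc)

text \<open>A cubic is expanded about \<open>-2\<close> because the differences used by \<open>\<Delta>\<^sup>4f(y)\<close> are centred at \<open>y + 2\<close>; the final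
  sums then depend on \<open>b\<^sub>0\<close> and \<open>b\<^sub>2\<close> alone.\<close>
context
  fixes q :: "real \<Rightarrow> real" and b0 b1 b2 b3 :: real
  assumes q: "\<And>y. q y = b0 + b1 * (y + 2) + b2 * (y + 2)^2 + b3 * (y + 2)^3"
begin

text \<open>The \<open>i\<close>-th difference of \<open>q\<close> has degree at most \<open>3 - i\<close>. It is taken at the points where it occurs in the boundary
  term, in expanded form, so that its growth can be read off.\<close>
lemma fdiff_cubic:
  "q (y - 1) = b0 + b1 * (y + 1) + b2 * (y + 1)^2 + b3 * (y + 1)^3"
  "fdiff q (y - 2) = b1 + b2 * (2 * y + 1) + b3 * (3 * y^2 + 3 * y + 1)"
  "(fdiff ^^ 2) q (y - 3) = 2 * b2 + 6 * b3 * y"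
  "(fdiff ^^ 3) q (y - 4) = 6 * b3"
  "(fdiff ^^ 4) q (y - 4) = 0"
  by (simp_all add: fdiff_def q eval_nat_numeral algebra_simps)

text \<open>In each summand the growth \<open>y\<^sup>3\<^sup>-\<^sup>i\<close> of \<open>\<Delta>\<^sup>iq\<close> meets \<open>\<Delta>\<^sup>3\<^sup>-\<^sup>ih\<close>, which is of smaller order than its reciprocal.\<close>
lemma parts_boundary_tendsto_0:
  assumes A: "A = at_top \<or> A = at_bot"
    and h: "\<And>j. j < 4 \<Longrightarrow> ((\<lambda>y. y ^ j * (fdiff ^^ j) h y) \<longlongrightarrow> 0) A"
  shows "(parts_boundary 4 q h \<longlongrightarrow> 0) A"
proof -
  have "((\<lambda>y. q (y - 1) / y ^ 3) \<longlongrightarrow> b3) A" "((\<lambda>y. fdiff q (y - 2) / y ^ 2) \<longlongrightarrow> 3 * b3) A"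
    "((\<lambda>y. (fdiff ^^ 2) q (y - 3) / y) \<longlongrightarrow> 6 * b3) A"
    using A unfolding fdiff_cubic by (elim disjE; simp; real_asymp)+
  from tendsto_mult [OF this(1) h [of 3]] tendsto_mult [OF this(2) h [of 2]] tendsto_mult [OF this(3) h [of 1]]
    tendsto_mult [OF tendsto_const [of "6 * b3"] h [of 0]]
  have "((\<lambda>y. q (y - 1) / y ^ 3 * (y ^ 3 * (fdiff ^^ 3) h y) - fdiff q (y - 2) / y ^ 2 * (y ^ 2 * (fdiff ^^ 2) h y)
      + (fdiff ^^ 2) q (y - 3) / y * (y ^ 1 * (fdiff ^^ 1) h y) - 6 * b3 * (y ^ 0 * (fdiff ^^ 0) h y))
      \<longlongrightarrow> b3 * 0 - 3 * b3 * 0 + 6 * b3 * 0 - 6 * b3 * 0) A"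
    by (intro tendsto_diff tendsto_add) simp_all
  moreover from eventually_neq_0_at_ends [OF A]
  have "eventually (\<lambda>y. q (y - 1) / y ^ 3 * (y ^ 3 * (fdiff ^^ 3) h y) - fdiff q (y - 2) / y ^ 2 * (y ^ 2 * (fdiff ^^ 2) h y)
      + (fdiff ^^ 2) q (y - 3) / y * (y ^ 1 * (fdiff ^^ 1) h y) - 6 * b3 * (y ^ 0 * (fdiff ^^ 0) h y) = parts_boundary 4 q h y) A"
    by eventually_elim (simp add: parts_boundary_4 fdiff_cubic(4))
  ultimately show ?thesis
    by (simp add: Lim_transform_eventually)
qed

text \<open>The fourth difference of a cubic vanishes, so its boundary term is 1-periodic; being also a
  polynomial in \<open>y\<close>, it is constant.\<close>
lemma parts_boundary_cubic:
  "parts_boundary 4 q (\<lambda>y. \<sigma> * cubic_deriv c 0 y) y =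
     \<sigma> * (6 * b0 + (2 + 3 * c\<^sup>2) * b2)"
  unfolding parts_boundary_4 fdiff_cubic
  by (simp add: fdiff_def cubic_deriv_def eval_nat_numeral) algebra

text \<open>Near \<open>\<sigma>\<infinity>\<close> the multiquadric differs from \<open>\<sigma>\<close> times the cubic by a function whose boundary term tends to 0.\<close>
lemma parts_boundary_multiquadric:
  assumes c: "c > 0" and A: "A = at_top \<and> \<sigma> = 1 \<or> A = at_bot \<and> \<sigma> = -1"
  shows "(parts_boundary 4 q (multiquadric_deriv c 0) \<longlongrightarrow> \<sigma> * (6 * b0 + (2 + 3 * c\<^sup>2) * b2)) A"
proof -
  define h where "h = (\<lambda>n y. multiquadric_deriv c n y - \<sigma> * cubic_deriv c n y)"
  have "((\<lambda>y. y ^ j * (fdiff ^^ j) (h 0) y) \<longlongrightarrow> 0) A" if "j < 4" for j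
  proof (rule tendsto_power_mult_fdiff)
    show "(h i has_real_derivative h (Suc i) y) (at y)" if "i < j" for i y
      unfolding h_def using that \<open>j < 4\<close>
      by (intro DERIV_diff DERIV_cmult DERIV_multiquadric_deriv DERIV_cubic_deriv c) auto
    show "((\<lambda>y. y ^ j * h j y) \<longlongrightarrow> 0) A"
      using \<open>j < 4\<close> A multiquadric_asymptotics_top(1-4) [OF c] multiquadric_asymptotics_bot(1-4) [OF c]
      unfolding h_def lt4 by (elim disjE conjE) simp_all
  qed (use A in auto)
  then have "(parts_boundary 4 q (h 0) \<longlongrightarrow> 0) A"
    using A by (intro parts_boundary_tendsto_0) auto
  moreover have "parts_boundary 4 q (h 0) =
      (\<lambda>y. parts_boundary 4 q (multiquadric_deriv c 0) y - \<sigma> * (6 * b0 + (2 + 3 * c\<^sup>2) * b2))"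
    by (rule ext) (simp only: h_def parts_boundary_diff parts_boundary_cubic)
  ultimately have "((\<lambda>y. parts_boundary 4 q (multiquadric_deriv c 0) y - \<sigma> * (6 * b0 + (2 + 3 * c\<^sup>2) * b2)) \<longlongrightarrow> 0) A"
    by simp
  then show ?thesis
    by (rule LIM_zero_cancel)
qed

text \<open>The value is the difference of the limits \<open>K\<close> and \<open>-K\<close> of the boundary term at the two ends.\<close>
lemma has_sum_cubic_fdiff:
  assumes c: "c > 0"
  shows "((\<lambda>k::int. q (x + of_int k) * (fdiff ^^ 4) (multiquadric_deriv c 0) (x + of_int k)) has_sum
    (12 * b0 + (4 + 6 * c\<^sup>2) * b2)) UNIV"
proof -
  let ?K = "6 * b0 + (2 + 3 * c\<^sup>2) * b2"
  have dec: "((\<lambda>y. y\<^sup>2 * (q y * (fdiff ^^ 4) (multiquadric_deriv c 0) y)) \<longlongrightarrow> b3 * L) A"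
    if A: "A = at_top \<or> A = at_bot" and "((\<lambda>y. y ^ 5 * multiquadric_deriv c 4 y) \<longlongrightarrow> L) A" for A L
  proof -
    have "((\<lambda>y. y ^ 5 * (fdiff ^^ 4) (multiquadric_deriv c 0) y) \<longlongrightarrow> L) A"
      using that by (intro tendsto_power_mult_fdiff DERIV_multiquadric_deriv c)
    moreover have "((\<lambda>y. q y / y ^ 3) \<longlongrightarrow> b3) A"
      using A unfolding q by (elim disjE; simp; real_asymp)
    ultimately have "((\<lambda>y. q y / y ^ 3 * (y ^ 5 * (fdiff ^^ 4) (multiquadric_deriv c 0) y)) \<longlongrightarrow> b3 * L) A"
      by (rule tendsto_mult [rotated])
    moreover from eventually_neq_0_at_ends [OF A]
    have "eventually (\<lambda>y. q y / y ^ 3 * (y ^ 5 * (fdiff ^^ 4) (multiquadric_deriv c 0) y) =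
        y\<^sup>2 * (q y * (fdiff ^^ 4) (multiquadric_deriv c 0) y)) A"
      by eventually_elim (simp add: field_simps eval_nat_numeral)
    ultimately show ?thesis by (rule Lim_transform_eventually)
  qed
  have "((\<lambda>k::int. q (x + of_int k) * (fdiff ^^ 4) (multiquadric_deriv c 0) (x + of_int k)) has_sum (1 * ?K - (-1) * ?K)) UNIV"
  proof (rule has_sum_int_telescope)
    show "q y * (fdiff ^^ 4) (multiquadric_deriv c 0) y =
        parts_boundary 4 q (multiquadric_deriv c 0) (y + 1) - parts_boundary 4 q (multiquadric_deriv c 0) y" for y
      using fdiff_cubic(5) [of y] by (simp add: fdiff_parts_boundary)
    show "(parts_boundary 4 q (multiquadric_deriv c 0) \<longlongrightarrow> 1 * ?K) at_top"
      "(parts_boundary 4 q (multiquadric_deriv c 0) \<longlongrightarrow> (-1) * ?K) at_bot"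
      by (rule parts_boundary_multiquadric [OF c]; simp)+
  qed (rule dec [OF _ multiquadric_asymptotics_top(5) [OF c]] dec [OF _ multiquadric_asymptotics_bot(5) [OF c]]; simp)+
  then show ?thesis by (simp add: algebra_simps)
qed

end

section \<open>Reproduction of cubic polynomials\<close>

text \<open>The coefficients of the quotient of \<open>\<Sum>\<^sub>k \<mu>\<^sub>k z\<^sup>k\<close> by the symbol \<open>z\<^sup>-\<^sup>2(z - 1)\<^sup>4\<close> of the centred fourth difference,
  found by long division from the outermost coefficients. Only \<open>\<bar>j\<bar> \<le> 2\<close> is meant; other \<open>j\<close> get the
  value at 0.\<close>
definition fdiff_weight :: "real \<Rightarrow> int \<Rightarrow> real" where
  "fdiff_weight c j = (if \<bar>j\<bar> = 2 then \<mu> c 4 else if \<bar>j\<bar> = 1 then \<mu> c 3 + 4 * \<mu> c 4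
     else \<mu> c 2 + 4 * \<mu> c 3 + 10 * \<mu> c 4)"

lemma fdiff_4: "(fdiff ^^ 4) f y = f (y + 4) - 4 * f (y + 3) + 6 * f (y + 2) - 4 * f (y + 1) + f y"
  by (simp add: fdiff_def eval_nat_numeral add.assoc)

lemma int_intervals: "{-4..4::int} = {-4,-3,-2,-1,0,1,2,3,4}" "{-2..2::int} = {-2,-1,0,1,2}"
  by auto

text \<open>The division is exact. The three outer coefficients on either side hold by the definition of the weights; those of
  index 0 and \<open>\<plusminus>1\<close> express that \<open>\<mu>\<close> has vanishing moments of orders 0 and 2.\<close>
lemma quasi_lagrange_eq_fdiff:
  "quasi_lagrange c x =
     (\<Sum>j=-2..2. fdiff_weight c j * (fdiff ^^ 4) (multiquadric_deriv c 0) (x - of_int j - 2))"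
proof -
  have even: "\<mu> c (- k) = \<mu> c k" for k by (simp add: \<mu>_def)
  have "\<mu> c 1 = 7 * fdiff_weight c 1 - 4 * fdiff_weight c 0 - 4 * fdiff_weight c 2"
    "\<mu> c 0 = 6 * fdiff_weight c 0 - 8 * fdiff_weight c 1 + 2 * fdiff_weight c 2"
    unfolding fdiff_weight_def \<mu>_def by (simp_all add: field_simps)
  then show ?thesis
    unfolding quasi_lagrange_def multiquadric_eq_deriv_0 int_intervals fdiff_4
    by (simp add: even) (simp add: fdiff_weight_def algebra_simps)
qed

text \<open>These are the normalisation \<open>\<Sum>\<^sub>j w\<^sub>j = 1/12\<close> and half of the second moment
  \<open>\<Sum>\<^sub>j j\<^sup>2 w\<^sub>j = - (2 + 3 c\<^sup>2) / 72\<close>.\<close>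
lemma fdiff_weight_moments:
  "fdiff_weight c 0 + 2 * fdiff_weight c 1 + 2 * fdiff_weight c 2 = 1 / 12"
  "fdiff_weight c 1 + 4 * fdiff_weight c 2 = - (2 + 3 * c\<^sup>2) / 144"
  unfolding fdiff_weight_def \<mu>_def by (simp_all add: field_simps)

lemma poly_cubic:
  fixes p :: "real poly"
  assumes "degree p \<le> 3"
  shows "poly p t = coeff p 0 + coeff p 1 * t + coeff p 2 * t\<^sup>2 + coeff p 3 * t ^ 3"
proof -
  have "poly p t = (\<Sum>i\<le>3. coeff p i * t ^ i)"
    unfolding poly_altdef using assms
    by (intro sum.mono_neutral_left) (auto simp: coeff_eq_0)
  then show ?thesis by (simp add: eval_nat_numeral)
qed

text \<open>Here \<open>coeff p 2 + 3 * coeff p 3 * z\<close> is \<open>p''(z) / 2\<close>. The substitution \<open>k \<mapsto> -k\<close> turns the convolution into a sum of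
  \<open>q(y) = p(z - 2 - y)\<close> along \<open>z - 2 + \<int>\<close>, and \<open>b\<^sub>0 = p(z)\<close>, \<open>b\<^sub>2 = p''(z)/2\<close> are the Taylor coefficients of \<open>q\<close> at
  \<open>-2\<close>.\<close>
lemma has_sum_poly_fdiff:
  fixes p :: "real poly"
  assumes c: "c > 0" and p: "degree p \<le> 3"
  shows "((\<lambda>k::int. poly p (of_int k) * (fdiff ^^ 4) (multiquadric_deriv c 0) (z - of_int k - 2)) has_sum
    (12 * poly p z + (4 + 6 * c\<^sup>2) * (coeff p 2 + 3 * coeff p 3 * z))) UNIV"
proof -
  let ?q = "\<lambda>y. poly p (z - 2 - y)"
  have "?q y = poly p z + (- coeff p 1 - 2 * coeff p 2 * z - 3 * coeff p 3 * z\<^sup>2) * (y + 2)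
      + (coeff p 2 + 3 * coeff p 3 * z) * (y + 2)\<^sup>2 + (- coeff p 3) * (y + 2) ^ 3" for y
    unfolding poly_cubic [OF p] by algebra
  from has_sum_cubic_fdiff [of ?q, OF this c, where x = "z - 2"]
  have "((\<lambda>k::int. poly p (of_int (- k)) * (fdiff ^^ 4) (multiquadric_deriv c 0) (z - of_int (- k) - 2)) has_sum
    (12 * poly p z + (4 + 6 * c\<^sup>2) * (coeff p 2 + 3 * coeff p 3 * z))) UNIV"
    by (simp add: algebra_simps)
  then show ?thesis
    by (subst (asm) has_sum_reindex_bij_betw [where g = uminus and B = UNIV]) (auto simp: bij_uminus)
qed

theorem theorem9:
  fixes c :: real and p :: "real poly" and x :: real
  assumes "c > 0" and "degree p \<le> 3"
  shows "((\<lambda>k::int. poly p (of_int k) * quasi_lagrange c (x - of_int k)) has_sum poly p x) UNIV"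
proof -
  have "((\<lambda>k::int. \<Sum>j=-2..2. fdiff_weight c j * (poly p (of_int k) * (fdiff ^^ 4) (multiquadric_deriv c 0) (x - of_int j - of_int k - 2)))
     has_sum (\<Sum>j=-2..2. fdiff_weight c j * (12 * poly p (x - of_int j)
        + (4 + 6 * c\<^sup>2) * (coeff p 2 + 3 * coeff p 3 * (x - of_int j))))) UNIV"
    by (intro has_sum_finite_sum has_sum_cmult_right has_sum_poly_fdiff assms) auto
  moreover have "(\<Sum>j=-2..2. fdiff_weight c j * (poly p (of_int k) * (fdiff ^^ 4) (multiquadric_deriv c 0) (x - of_int j - of_int k - 2))) =
      poly p (of_int k) * quasi_lagrange c (x - of_int k)" for k :: int
    unfolding quasi_lagrange_eq_fdiff sum_distrib_left by (intro sum.cong) (simp_all add: algebra_simps)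
  \<comment> \<open>With \<open>p(x - j)\<close> expanded about \<open>x\<close>, the odd terms cancel by symmetry, and the second moment makes
      \<open>\<Sum>\<^sub>j w\<^sub>j 12 (j\<^sup>2/2) p''(x)\<close> cancel \<open>\<Sum>\<^sub>j w\<^sub>j (2 + 3 c\<^sup>2) p''(x)\<close>.\<close>
  moreover have "(\<Sum>j=-2..2. fdiff_weight c j * (12 * poly p (x - of_int j)
        + (4 + 6 * c\<^sup>2) * (coeff p 2 + 3 * coeff p 3 * (x - of_int j)))) = poly p x"
  proof -
    have sym: "fdiff_weight c (-1) = fdiff_weight c 1" "fdiff_weight c (-2) = fdiff_weight c 2"
      by (simp_all add: fdiff_weight_def)
    let ?b2 = "coeff p 2 + 3 * coeff p 3 * x"
    have "(\<Sum>j=-2..2. fdiff_weight c j * (12 * poly p (x - of_int j)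
        + (4 + 6 * c\<^sup>2) * (coeff p 2 + 3 * coeff p 3 * (x - of_int j)))) =
      (fdiff_weight c 0 + 2 * fdiff_weight c 1 + 2 * fdiff_weight c 2) * (12 * poly p x + (4 + 6 * c\<^sup>2) * ?b2)
        + (fdiff_weight c 1 + 4 * fdiff_weight c 2) * (24 * ?b2)"
      unfolding poly_cubic [OF assms(2)] int_intervals by (simp add: sym) algebra
    also have "\<dots> = 1 / 12 * (12 * poly p x + (4 + 6 * c\<^sup>2) * ?b2) + - (2 + 3 * c\<^sup>2) / 144 * (24 * ?b2)"
      unfolding fdiff_weight_moments ..
    also have "\<dots> = poly p x"
      by (simp add: field_simps)
    finally show ?thesis .
  qed
  ultimately show ?thesis by simp
qed

end
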